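(* If $f\in C^2(\mathbb T,\mathbb T)$ is expanding, then any c-constant function $A\in C^1(\mathbb T,\mathbb R)$ of zero average (with respect to the absolutely continuous $f$-invariant probability measure) is necessarily a coboundary, i.e. there is $\phi\in C^1(\mathbb T,\mathbb R)$ with $A=\phi-\phi\circ f$.
   Context: $\mathbb T=\mathbb R/\mathbb Z$; expanding means $f'\ge\lambda$ for some $\lambda>1$. The domains of invertibility of $f$ are the maximal intervals of the partition of $\mathbb T$ on which $f$ is injective, cut at the preimages of a fixed point of $f$ (placed at $0$), so that each domain is mapped by $f$ onto $\mathbb T$ (minus a point). A real function $A\in C^1(\mathbb T)$ is called c-constant (with respect to $f$) if there is a function $\beta$ of bounded variation such that $A+\beta\circ f-\beta$ is constant on each domain of invertibility of $f$. *)

theory Defs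
  imports "HOL-Probability.Probability"
begin

section \<open>The circle as the quotient of the reals by the integers\<close>

quotient_type circle = real / "\<lambda>x y. x - y \<in> \<int>"
  morphisms rep_circle to_circle
proof (rule equivpI)
  show "reflp (\<lambda>x y :: real. x - y \<in> \<int>)"
    by (simp add: reflp_def)
  show "symp (\<lambda>x y :: real. x - y \<in> \<int>)"
    unfolding symp_def by (metis Ints_minus minus_diff_eq)
  show "transp (\<lambda>x y :: real. x - y \<in> \<int>)"
    unfolding transp_def by (metis Ints_add diff_add_cancel add_diff_eq)
qed

text \<open>The topology is the quotient topology; \<open>borel :: circle measure\<close> refers to it.\<close>

instantiation circle :: topological_space
begin

definition open_circle :: "circle set \<Rightarrow> bool"
  where "open_circle U \<longleftrightarrow> open (to_circle -` U)"

instance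
  by standard (auto simp: open_circle_def vimage_Int vimage_Union intro!: open_UN)

end

lemma to_circle_eq_iff: "to_circle x = to_circle y \<longleftrightarrow> x - y \<in> \<int>"
  by (fact circle.abs_eq_iff)

lemma continuous_to_circle: "continuous_on UNIV to_circle"
  by (simp add: continuous_on_open_vimage open_circle_def)

definition circle_lebesgue :: "circle measure"
  where "circle_lebesgue = distr (restrict_space lborel {0..<1}) borel to_circle"


section \<open>Regularity of functions and maps on the circle\<close>

definition C1_circle_fun :: "(circle \<Rightarrow> real) \<Rightarrow> bool"
  where "C1_circle_fun A \<longleftrightarrow> (\<lambda>x. A (to_circle x)) C1_differentiable_on UNIV"

text \<open>A continuous lift of a circle map is unique up to an additive integer constant, so its
  derivatives are those of the circle map.\<close>

definition is_lift :: "(real \<Rightarrow> real) \<Rightarrow> (circle \<Rightarrow> circle) \<Rightarrow> bool"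
  where "is_lift F f \<longleftrightarrow>
    continuous_on UNIV F \<and> (\<forall>x. to_circle (F x) = f (to_circle x))"

definition C2_circle_map :: "(circle \<Rightarrow> circle) \<Rightarrow> bool"
  where "C2_circle_map f \<longleftrightarrow>
    (\<exists>F. is_lift F f \<and> (\<forall>x. F differentiable at x) \<and> deriv F C1_differentiable_on UNIV)"

definition expanding :: "(circle \<Rightarrow> circle) \<Rightarrow> bool"
  where "expanding f \<longleftrightarrow>
    (\<exists>F l. is_lift F f \<and> l > 1 \<and> (\<forall>x. F differentiable at x \<and> deriv F x \<ge> l))"

text \<open>Partitions of the circle may be taken to start and end at the point \<open>to_circle 0\<close>, since
  adding a cut point does not decrease the variation sum.\<close>

definition bounded_variation :: "(circle \<Rightarrow> real) \<Rightarrow> bool"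
  where "bounded_variation \<beta> \<longleftrightarrow>
    (\<exists>M. \<forall>(n :: nat) (t :: nat \<Rightarrow> real). mono_on {..n} t \<and> t ` {..n} \<subseteq> {0..1} \<longrightarrow>
      (\<Sum>i<n. \<bar>\<beta> (to_circle (t (Suc i))) - \<beta> (to_circle (t i))\<bar>) \<le> M)"


section \<open>Domains of invertibility and c-constant functions\<close>

definition circle_interval :: "circle set \<Rightarrow> bool"
  where "circle_interval D \<longleftrightarrow> (\<exists>I :: real set. is_interval I \<and> D = to_circle ` I)"

text \<open>The fixed point \<open>p\<close> is a parameter instead of being moved to \<open>to_circle 0\<close> by a rotation.
  The cut points are excluded: the domains are open intervals, each mapped onto the circle
  minus \<open>p\<close>.\<close>

definition uncut_injective :: "(circle \<Rightarrow> circle) \<Rightarrow> circle \<Rightarrow> circle set \<Rightarrow> bool"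
  where "uncut_injective f p D \<longleftrightarrow> circle_interval D \<and> D \<inter> f -` {p} = {} \<and> inj_on f D"

definition invertibility_domain :: "(circle \<Rightarrow> circle) \<Rightarrow> circle \<Rightarrow> circle set \<Rightarrow> bool"
  where "invertibility_domain f p D \<longleftrightarrow>
    uncut_injective f p D \<and> (\<forall>D'. uncut_injective f p D' \<and> D \<subseteq> D' \<longrightarrow> D' = D)"

definition c_constant :: "(circle \<Rightarrow> circle) \<Rightarrow> circle \<Rightarrow> (circle \<Rightarrow> real) \<Rightarrow> bool"
  where "c_constant f p A \<longleftrightarrow>
    (\<exists>\<beta>. bounded_variation \<beta> \<and>
      (\<forall>D. invertibility_domain f p D \<longrightarrow> (\<lambda>x. A x + \<beta> (f x) - \<beta> x) constant_on D))"


section \<open>Absolutely continuous invariant probability measures\<close>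

text \<open>In the library, \<open>absolutely_continuous M N\<close> says that \<open>N\<close> is absolutely continuous with
  respect to \<open>M\<close>.\<close>

definition ac_invariant_prob :: "(circle \<Rightarrow> circle) \<Rightarrow> circle measure \<Rightarrow> bool"
  where "ac_invariant_prob f \<mu> \<longleftrightarrow>
    prob_space \<mu> \<and> sets \<mu> = sets borel \<and> absolutely_continuous circle_lebesgue \<mu> \<and>
    f \<in> measurable \<mu> \<mu> \<and> distr \<mu> \<mu> f = \<mu>"

end

theory Submission
  imports Defs
begin

text \<open>
  Lift everything to the line. Let \<open>P\<close> represent the fixed point, let \<open>F\<close> be the lift of \<open>f\<close> that
  fixes \<open>P\<close>, and let \<open>G\<close> be its inverse, a contraction with fixed point \<open>P\<close>. The functions \<open>a\<close> and
  \<open>b\<close> are the periodic lifts of \<open>A\<close> and \<open>\<beta>\<close>. The maps \<open>x \<mapsto> G (x + m)\<close>, with \<open>x\<close> in the cell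
  \<open>(P, P + 1)\<close>, are the inverse branches of \<open>f\<close>; their images are the domains of invertibility, so
  c-constancy says that \<open>b x - b y\<close> is \<open>b (G x) - b (G y) - (a (G x) - a (G y))\<close> for \<open>x, y\<close> in a
  common cell \<open>(P + m, P + m + 1)\<close>. Since \<open>G\<close> maps cells into cells, this can be iterated
  (\<open>increment_along_inverse_branch\<close>).

  The main point is that bounded variation forces \<open>\<beta>\<close> to be Lipschitz away from the fixed point
  (\<open>b_lipschitz_on_unit_cell\<close>). Under iteration the terms in \<open>a\<close> sum to at most a constant times
  \<open>\<bar>x - y\<bar>\<close>, as \<open>a\<close> is Lipschitz and \<open>G\<close> contracts. The remaining term is the increment of \<open>b\<close> over the
  image of \<open>[x, y]\<close> under an inverse branch of an iterate of \<open>f\<close>. There are arbitrarily many such images,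
  pairwise disjoint, and the increments over all of them add up to at most the variation; so some of
  them are arbitrarily small.

  Once \<open>b\<close> is Lipschitz on cells, the remaining term tends to 0 along every sequence of inverse
  branches, in particular along the iterates of \<open>G\<close>. On each cell, therefore, \<open>b\<close> differs by a constant
  from the series \<open>\<psi> x = - (\<Sum>k. a (G\<^sup>k\<^sup>+\<^sup>1 x) - a P)\<close> (\<open>b_minus_\<psi>_constant_on_cell\<close>). This series makes
  sense on the whole line, is \<open>C\<^sup>1\<close> there, and telescopes to \<open>a = a P + \<psi> - \<psi> \<circ> F\<close>.

  It remains to see that \<open>\<psi>\<close> is periodic (\<open>\<psi>_shift_1\<close>), that is, that the possible jump of \<open>\<beta>\<close> at the
  fixed point vanishes after the correction. As \<open>b\<close> is periodic, \<open>\<psi> (x + 1) - \<psi> x\<close> is constant on each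
  cell, hence a constant \<open>J\<close> by continuity. With \<open>F (x + 1) = F x + d\<close> the cohomological equation gives
  \<open>J = d * J\<close>, and \<open>d > 1\<close> yields \<open>J = 0\<close>. So \<open>\<psi>\<close> descends to a \<open>C\<^sup>1\<close> function \<open>\<phi>\<close> on the circle with
  \<open>A = A p + \<phi> - \<phi> \<circ> f\<close>, and integrating against the invariant measure shows \<open>A p = 0\<close>.
\<close>

section \<open>Periodic and integer-valued functions on the line\<close>

lemma periodic_shift:
  fixes g :: "real \<Rightarrow> 'a"
  assumes "\<And>x. g (x + 1) = g x"
  shows "g (x + of_int k) = g x"
proof (induction k rule: int_induct[where k = 0])
  case (step1 i)
  thus ?case
    using assms[of "x + of_int i"] by (simp add: add.assoc)
next
  case (step2 i)
  thus ?case
    using assms[of "x + of_int (i - 1)"] by (simp add: algebra_simps)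
qed simp

lemma periodic_continuous_bounded:
  fixes g :: "real \<Rightarrow> real"
  assumes "\<And>x. g (x + 1) = g x" and "continuous_on UNIV g"
  shows "\<exists>K. \<forall>x. \<bar>g x\<bar> \<le> K"
proof -
  have "bounded (g ` {0..1})"
    using assms(2) by (intro compact_imp_bounded compact_continuous_image) (auto intro: continuous_on_subset)
  then obtain K where K: "\<forall>x\<in>{0..1}. \<bar>g x\<bar> \<le> K"
    unfolding bounded_iff by auto
  have "\<bar>g x\<bar> \<le> K" for x
    using bspec[OF K, of "frac x"] periodic_shift[of g "frac x" "\<lfloor>x\<rfloor>", OF assms(1)] frac_lt_1[of x]
    by (simp add: frac_def)
  thus ?thesis
    by blast
qed

lemma continuous_integer_valued_constant:
  fixes h :: "real \<Rightarrow> real"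
  assumes "continuous_on UNIV h" and "\<And>x. h x \<in> \<int>"
  shows "h x = h y"
proof -
  have "h constant_on UNIV"
  proof (rule continuous_discrete_range_constant[OF _ assms(1)])
    show "\<exists>e>0. \<forall>y. y \<in> UNIV \<and> h y \<noteq> h x \<longrightarrow> e \<le> norm (h y - h x)" for x
      using assms(2) Ints_nonzero_abs_ge1[of "h _ - h x"]
      by (intro exI[of _ 1]) (auto simp: Ints_diff)
  qed simp
  thus ?thesis
    unfolding constant_on_def by auto
qed


section \<open>Summing a function along the orbits of a contraction\<close>

lemma funpow_contraction:
  fixes G :: "real \<Rightarrow> real"
  assumes "\<And>x y. \<bar>G x - G y\<bar> \<le> r * \<bar>x - y\<bar>" and "0 \<le> r"
  shows "\<bar>(G ^^ n) x - (G ^^ n) y\<bar> \<le> r ^ n * \<bar>x - y\<bar>"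
proof (induction n)
  case (Suc n)
  have "\<bar>(G ^^ Suc n) x - (G ^^ Suc n) y\<bar> \<le> r * \<bar>(G ^^ n) x - (G ^^ n) y\<bar>"
    using assms(1) by simp
  also have "\<dots> \<le> r * (r ^ n * \<bar>x - y\<bar>)"
    using Suc assms(2) by (rule mult_left_mono)
  finally show ?case by (simp add: mult.assoc)
qed simp

lemma funpow_has_real_derivative:
  fixes G :: "real \<Rightarrow> real"
  assumes "\<And>x. (G has_real_derivative G' x) (at x)"
  shows "((G ^^ n) has_real_derivative (\<Prod>i<n. G' ((G ^^ i) x))) (at x)"
proof (induction n)
  case 0
  show ?case by (simp add: id_def)
next
  case (Suc n)
  show ?case
    using DERIV_chain[OF assms Suc] by (simp add: o_def mult.commute)
qed

lemma real_lipschitz_if_derivative_bounded: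
  fixes a :: "real \<Rightarrow> real"
  assumes "\<And>x. (a has_real_derivative a' x) (at x)" and "\<And>x. \<bar>a' x\<bar> \<le> K"
  shows "\<bar>a x - a y\<bar> \<le> K * \<bar>x - y\<bar>"
  using field_differentiable_bound[of UNIV a a' K x y] assms by simp

text \<open>The chain rule bounds the derivatives of the terms by the geometric series
  \<open>K * r ^ Suc k\<close>, so the series of derivatives converges uniformly on the line, and at \<open>P\<close> all terms of
  the original series vanish. The base point \<open>P\<close> is subtracted because \<open>a\<close> along an orbit tends to \<open>a P\<close>.\<close>

lemma contraction_orbit_sum_C1:
  fixes G a :: "real \<Rightarrow> real"
  assumes G: "\<And>x. (G has_real_derivative G' x) (at x)"
    and G'_cont: "continuous_on UNIV G'"
    and G'_le: "\<And>x. \<bar>G' x\<bar> \<le> r" and r: "0 \<le> r" "r < 1"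
    and fixed: "G P = P"
    and a: "\<And>x. (a has_real_derivative a' x) (at x)"
    and a'_cont: "continuous_on UNIV a'"
    and a'_le: "\<And>x. \<bar>a' x\<bar> \<le> K"
  defines "s \<equiv> \<lambda>x. \<Sum>k. a ((G ^^ Suc k) x) - a P"
  shows "summable (\<lambda>k. a ((G ^^ Suc k) x) - a P)"
    and "\<exists>s'. continuous_on UNIV s' \<and> (\<forall>x. (s has_real_derivative s' x) (at x))"
proof -
  define t' where "t' = (\<lambda>k x. a' ((G ^^ Suc k) x) * (\<Prod>i<Suc k. G' ((G ^^ i) x)))"
  have orbit_fixed: "(G ^^ n) P = P" for n
    using fixed by (induction n) auto
  have funpow_cont: "continuous_on UNIV (G ^^ n)" for n
    using funpow_has_real_derivative[OF G] by (meson DERIV_continuous_on has_field_derivative_at_within)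
  have t'_cont: "continuous_on UNIV (t' k)" for k
    unfolding t'_def
    by (intro continuous_intros continuous_on_compose2[OF a'_cont funpow_cont]
        continuous_on_compose2[OF G'_cont funpow_cont]) auto
  have term_deriv: "((\<lambda>x. a ((G ^^ Suc k) x) - a P) has_real_derivative t' k x) (at x)" for k x
    using DERIV_chain[OF a funpow_has_real_derivative[OF G], of "Suc k" x]
    unfolding t'_def o_def by (auto intro!: derivative_eq_intros simp del: funpow.simps prod.lessThan_Suc)
  have K: "0 \<le> K"
    using a'_le[of 0] by linarith
  have t'_le: "norm (t' k x) \<le> K * r ^ Suc k" for k x
  proof -
    have "(\<Prod>i<Suc k. \<bar>G' ((G ^^ i) x)\<bar>) \<le> (\<Prod>i<Suc k. r)"
      by (intro prod_mono) (use G'_le in auto)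
    hence "\<bar>a' ((G ^^ Suc k) x)\<bar> * (\<Prod>i<Suc k. \<bar>G' ((G ^^ i) x)\<bar>) \<le> K * r ^ Suc k"
      using a'_le[of "(G ^^ Suc k) x"] K
      by (intro mult_mono) (auto intro!: prod_nonneg simp del: prod.lessThan_Suc funpow.simps)
    thus ?thesis
      unfolding t'_def by (simp add: abs_mult abs_prod del: prod.lessThan_Suc funpow.simps)
  qed
  have majorant: "summable (\<lambda>k. K * r ^ Suc k)"
    using r by (intro summable_mult) (simp add: summable_Suc_iff)
  have unif: "uniform_limit UNIV (\<lambda>n x. \<Sum>k<n. t' k x) (\<lambda>x. \<Sum>k. t' k x) sequentially"
    by (rule Weierstrass_m_test[OF t'_le majorant])
  hence conv: "uniformly_convergent_on UNIV (\<lambda>n x. \<Sum>k<n. t' k x)"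
    by (auto simp: uniformly_convergent_on_def)
  have at_P: "summable (\<lambda>k. a ((G ^^ Suc k) P) - a P)"
    by (simp only: orbit_fixed) simp
  note series = has_field_derivative_series'[OF convex_UNIV has_field_derivative_at_within[OF term_deriv] conv
      UNIV_I at_P]
  show "summable (\<lambda>k. a ((G ^^ Suc k) x) - a P)"
    by (rule series) simp
  have "continuous_on UNIV (\<lambda>x. \<Sum>k. t' k x)"
    by (rule uniform_limit_theorem[OF _ unif]) (auto intro!: always_eventually continuous_on_sum t'_cont)
  moreover have "(s has_real_derivative (\<Sum>k. t' k x)) (at x)" for x
    unfolding s_def by (rule series) simp
  ultimately show "\<exists>s'. continuous_on UNIV s' \<and> (\<forall>x. (s has_real_derivative s' x) (at x))"
    by blast
qed


section \<open>The lift of an expanding map and its inverse\<close>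

text \<open>Among the lifts of a circle map with a fixed point, which differ by integers, the one
  considered here fixes a given representative \<open>P\<close> of that point. The integer \<open>d\<close> is the degree of the
  circle map.\<close>

locale expanding_lift =
  fixes F F' :: "real \<Rightarrow> real" and l P :: real and d :: int
  assumes F_deriv: "(F has_real_derivative F' x) (at x)"
    and F'_cont: "continuous_on UNIV F'"
    and expansion: "1 < l" "l \<le> F' x"
    and F_fixed: "F P = P"
    and F_shift_1: "F (x + 1) = F x + of_int d"
begin

lemma F_expands: "x \<le> y \<Longrightarrow> l * (y - x) \<le> F y - F x"
proof (cases "x < y")
  case True
  obtain z where "F y - F x = (y - x) * F' z"
    using MVT2[OF True, of F F'] F_deriv by blast
  thus ?thesis
    using True expansion(2)[of z] by (simp add: mult.commute mult_left_mono)
qed auto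

lemma F_strict_mono: "strict_mono F"
proof (rule strict_monoI)
  fix x y :: real assume xy: "x < y"
  have "0 < l * (y - x)"
    using xy expansion(1) by simp
  thus "F x < F y"
    using F_expands[of x y] xy by linarith
qed

lemma F_less_iff: "F x < F y \<longleftrightarrow> x < y"
  using F_strict_mono by (rule strict_mono_less)

lemma F_eq_iff: "F x = F y \<longleftrightarrow> x = y"
  using F_strict_mono by (rule strict_mono_eq)

lemma F_cont: "continuous_on UNIV F"
  using F_deriv by (meson DERIV_continuous_on has_field_derivative_at_within)

text \<open>By the mean value theorem \<open>F\<close> moves \<open>0\<close> and \<open>1\<close> to points at distance at least \<open>l > 1\<close>.\<close>

lemma degree_gt_1: "1 < d"
  using F_expands[of 0 1] F_shift_1[of 0] expansion(1) by simp

lemma F_shift: "F (x + of_int k) = F x + of_int (d * k)"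
proof (induction k rule: int_induct[where k = 0])
  case (step1 i)
  thus ?case
    using F_shift_1[of "x + of_int i"] by (simp add: algebra_simps)
next
  case (step2 i)
  thus ?case
    using F_shift_1[of "x + of_int (i - 1)"] by (simp add: algebra_simps)
qed simp

lemma F_surj: "surj F"
proof (unfold surj_def, rule allI)
  fix y
  define k where "k = max 1 \<lceil>\<bar>y - P\<bar>\<rceil>"
  have k: "\<bar>y - P\<bar> \<le> of_int k" "1 \<le> k"
    unfolding k_def by linarith+
  have "(of_int k :: real) \<le> of_int (d * k)"
    using k(2) degree_gt_1 by (subst of_int_le_iff) simp
  moreover have "F (P + of_int k) = P + of_int (d * k)" "F (P - of_int k) = P - of_int (d * k)"
    using F_shift[of P k] F_shift[of P "-k"] F_fixed by simp_all
  ultimately have "F (P - of_int k) \<le> y" "y \<le> F (P + of_int k)"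
    using k(1) by linarith+
  moreover have "P - of_int k \<le> P + of_int k"
    using k(2) by simp
  ultimately show "\<exists>x. y = F x"
    using IVT'[of F "P - of_int k" y "P + of_int k"] continuous_on_subset[OF F_cont] by blast
qed

definition G :: "real \<Rightarrow> real"
  where "G = inv F"

lemma F_G [simp]: "F (G x) = x"
  unfolding G_def using F_surj by (rule surj_f_inv_f)

lemma G_F [simp]: "G (F x) = x"
  using F_eq_iff F_G by blast

lemma G_less_iff: "G x < G y \<longleftrightarrow> x < y"
  using F_less_iff[of "G x" "G y"] by simp

lemma G_le_iff: "G x \<le> G y \<longleftrightarrow> x \<le> y"
  using G_less_iff[of y x] by linarith

lemma G_fixed: "G P = P"
  using G_F[of P] F_fixed by simp

lemma G_shift: "G (x + of_int (d * k)) = G x + of_int k"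
  using F_shift[of "G x" k] G_F[of "G x + of_int k"] by simp

lemma G_contracts: "\<bar>G x - G y\<bar> \<le> inverse l * \<bar>x - y\<bar>"
proof -
  have *: "\<bar>G x - G y\<bar> \<le> inverse l * \<bar>x - y\<bar>" if "x \<le> y" for x y
    using F_expands[of "G x" "G y"] that G_le_iff[of x y] expansion(1) by (simp add: field_simps)
  show ?thesis
    using *[of x y] *[of y x] by (cases "x \<le> y") (auto simp: abs_minus_commute)
qed

lemma funpow_G_contracts: "\<bar>(G ^^ n) x - (G ^^ n) y\<bar> \<le> inverse l ^ n * \<bar>x - y\<bar>"
  using expansion(1) by (intro funpow_contraction G_contracts) auto

lemma G_isCont: "isCont G x"
proof -
  have "continuous_on UNIV G"
    by (rule lipschitz_on_continuous_on[of "inverse l"])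
      (use G_contracts expansion(1) in \<open>auto simp: lipschitz_on_def dist_real_def\<close>)
  thus ?thesis
    by (simp add: continuous_on_eq_continuous_at)
qed

lemma F'_pos: "0 < F' x"
  using expansion(1) expansion(2)[of x] by linarith

lemma G_deriv: "(G has_real_derivative inverse (F' (G x))) (at x)"
  by (rule DERIV_inverse_function[of F _ _ _ "x - 1" "x + 1"])
    (use F_deriv F'_pos[of "G x"] G_isCont in auto)

lemma G'_cont: "continuous_on UNIV (\<lambda>x. inverse (F' (G x)))"
proof -
  have "continuous_on UNIV G"
    using G_isCont by (simp add: continuous_at_imp_continuous_on)
  hence "continuous_on UNIV (\<lambda>x. F' (G x))"
    by (intro continuous_on_compose2[OF F'_cont]) auto
  thus ?thesis
    using F'_pos by (intro continuous_intros) (auto simp: less_imp_neq[symmetric])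
qed

lemma G'_le: "\<bar>inverse (F' (G x))\<bar> \<le> inverse l"
  using expansion F'_pos[of "G x"] by (simp add: field_simps)

lemma contraction_rate: "0 \<le> inverse l" "inverse l < 1"
  using expansion(1) by (auto simp: field_simps)

lemma funpow_G_eq_iff: "(G ^^ n) x = z \<longleftrightarrow> x = (F ^^ n) z"
proof (induction n arbitrary: z)
  case (Suc n)
  have "(G ^^ Suc n) x = z \<longleftrightarrow> (G ^^ n) x = F z"
    by (metis F_G G_F comp_apply funpow.simps(2))
  also have "\<dots> \<longleftrightarrow> x = (F ^^ n) (F z)"
    by (rule Suc)
  finally show ?case
    by (simp add: funpow_swap1)
qed auto

lemma funpow_G_less_iff: "(G ^^ n) x < (G ^^ n) y \<longleftrightarrow> x < y"
  by (induction n) (auto simp: G_less_iff)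

lemma funpow_G_fixed: "(G ^^ n) P = P"
  using G_fixed by (induction n) auto

text \<open>The inverse iterates contract the distance to \<open>P\<close> by \<open>inverse l ^ n\<close>, so the forward iterates
  expand it by at least \<open>l ^ n\<close>.\<close>

lemma F_escapes:
  assumes "P < z"
  shows "\<exists>n. C \<le> (F ^^ n) z"
proof -
  have l0: "0 < l" using expansion(1) by linarith
  obtain n where n: "(C - P) / (z - P) < l ^ n"
    using real_arch_pow[OF expansion(1)] by blast
  have "inverse l ^ n * \<bar>(F ^^ n) z - P\<bar> \<ge> \<bar>z - P\<bar>"
    using funpow_G_contracts[of n "(F ^^ n) z" P] funpow_G_fixed[of n] funpow_G_eq_iff[of n "(F ^^ n) z" z]
    by simp
  hence "l ^ n * (z - P) \<le> \<bar>(F ^^ n) z - P\<bar>"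
    using assms l0 by (simp add: field_simps)
  moreover have "P \<le> (F ^^ n) z"
    using funpow_G_less_iff[of n P "(F ^^ n) z"] funpow_G_fixed[of n] funpow_G_eq_iff[of n "(F ^^ n) z" z] assms
    by simp
  moreover have "C - P < l ^ n * (z - P)"
    using n assms by (simp add: field_simps)
  ultimately show ?thesis
    by (intro exI[of _ n]) linarith
qed

text \<open>The connected components of the preimage, in the line, of the circle without the fixed point.\<close>

definition cell :: "int \<Rightarrow> real set"
  where "cell m = {P + of_int m <..< P + of_int m + 1}"

text \<open>By \<open>G_shift\<close> the map \<open>G\<close> sends \<open>P + d * k\<close> to \<open>P + k\<close>, so each cell has its image between two
  consecutive representatives of the fixed point.\<close>

lemma G_maps_cell:
  assumes "x \<in> cell m"
  shows "G x \<in> cell (m div d)"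
proof -
  have "d * (m div d) \<le> m" "m + 1 \<le> d * (m div d + 1)"
    using degree_gt_1 div_mult_mod_eq[of m d] pos_mod_bound[of d m] pos_mod_sign[of d m]
    unfolding distrib_left by (simp_all only: mult.commute[of d] mult_1_right) linarith+
  hence "(of_int (d * (m div d)) :: real) \<le> of_int m" "(of_int (m + 1) :: real) \<le> of_int (d * (m div d + 1))"
    by (simp_all only: of_int_le_iff)
  hence "P + of_int (d * (m div d)) < x" "x < P + of_int (d * (m div d + 1))"
    using assms by (auto simp: cell_def)
  hence "G (P + of_int (d * (m div d))) < G x" "G x < G (P + of_int (d * (m div d + 1)))"
    by (simp_all only: G_less_iff)
  thus ?thesis
    unfolding G_shift G_fixed by (simp add: cell_def)
qed

lemma funpow_G_maps_cell:
  "\<exists>m'. \<forall>x\<in>cell m. (G ^^ n) x \<in> cell m'"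
proof (induction n)
  case (Suc n)
  thus ?case
    using G_maps_cell by (metis comp_apply funpow.simps(2))
qed auto

end


section \<open>Regularity and periodicity of the transfer function on the line\<close>

lemma sum_even_indices_le:
  fixes u :: "nat \<Rightarrow> real"
  assumes "\<And>i. 0 \<le> u i"
  shows "(\<Sum>m<N. u (2 * m)) \<le> (\<Sum>i<2 * N. u i)"
  using assms by (induction N) (auto simp: add_increasing2 add.assoc intro!: add_mono)

text \<open>The last two assumptions express, for the lifts \<open>a\<close> and \<open>b\<close>, that the variation is bounded by \<open>M\<close>
  and that \<open>a + b \<circ> F - b\<close> is constant on each interval \<open>G ` cell m\<close>, which covers a domain of
  invertibility. The bound \<open>b_variation\<close> concerns partitions of \<open>[0, 1]\<close>, which is why \<open>P\<close> is placed in
  \<open>[0, 1)\<close>.\<close>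

locale c_constant_lift = expanding_lift +
  fixes a a' b :: "real \<Rightarrow> real" and K M :: real
  assumes a_deriv: "(a has_real_derivative a' x) (at x)"
    and a'_cont: "continuous_on UNIV a'"
    and a'_le: "\<bar>a' x\<bar> \<le> K"
    and a_shift_1: "a (x + 1) = a x"
    and b_shift_1: "b (x + 1) = b x"
    and P_in: "0 \<le> P" "P < 1"
    and b_variation: "mono_on {..n} t \<Longrightarrow> t ` {..n} \<subseteq> {0..1} \<Longrightarrow>
      (\<Sum>i<n. \<bar>b (t (Suc i)) - b (t i)\<bar>) \<le> M"
    and c_constant_on_cell: "x \<in> cell m \<Longrightarrow> y \<in> cell m \<Longrightarrow>
      a (G x) + b x - b (G x) = a (G y) + b y - b (G y)"
begin

lemma b_shift: "b (x + of_int m) = b x"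
  using b_shift_1 by (rule periodic_shift)

lemma a_lipschitz: "\<bar>a x - a y\<bar> \<le> K * \<bar>x - y\<bar>"
  using a_deriv a'_le by (rule real_lipschitz_if_derivative_bounded)

lemma K_nonneg: "0 \<le> K"
  using a'_le[of 0] by linarith

text \<open>Two points of a cell always stay in a common cell under \<open>G\<close>, so in each step the unknown
  constant of c-constancy cancels.\<close>

lemma increment_along_inverse_branch:
  assumes "x \<in> cell m" "y \<in> cell m"
  shows "b x - b y = b ((G ^^ n) x) - b ((G ^^ n) y) - (\<Sum>k<n. a ((G ^^ Suc k) x) - a ((G ^^ Suc k) y))"
proof (induction n)
  case (Suc n)
  obtain m' where "(G ^^ n) x \<in> cell m'" "(G ^^ n) y \<in> cell m'"
    using funpow_G_maps_cell[of m n] assms by blast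
  from c_constant_on_cell[OF this] Suc show ?case
    by simp
qed simp

text \<open>The Lipschitz constant of \<open>b\<close> on cells: the Lipschitz constant of \<open>a\<close> times the total contraction
  \<open>(inverse l) + (inverse l)\<^sup>2 + \<dots>\<close> along the orbits of \<open>G\<close>.\<close>

definition C :: real
  where "C = K * (\<Sum>k. inverse l ^ Suc k)"

lemma partial_sum_le:
  "\<bar>\<Sum>k<n. a ((G ^^ Suc k) x) - a ((G ^^ Suc k) y)\<bar> \<le> C * \<bar>x - y\<bar>"
proof -
  have "\<bar>a ((G ^^ Suc k) x) - a ((G ^^ Suc k) y)\<bar> \<le> K * (inverse l ^ Suc k * \<bar>x - y\<bar>)" for k
    using a_lipschitz[of "(G ^^ Suc k) x" "(G ^^ Suc k) y"]
      mult_left_mono[OF funpow_G_contracts[of "Suc k" x y] K_nonneg] by linarith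
  hence "\<bar>\<Sum>k<n. a ((G ^^ Suc k) x) - a ((G ^^ Suc k) y)\<bar>
      \<le> (\<Sum>k<n. K * (inverse l ^ Suc k * \<bar>x - y\<bar>))"
    by (intro order_trans[OF sum_abs] sum_mono)
  also have "\<dots> = K * (\<Sum>k<n. inverse l ^ Suc k) * \<bar>x - y\<bar>"
    by (simp add: sum_distrib_left sum_distrib_right mult.assoc)
  also have "(\<Sum>k<n. inverse l ^ Suc k) \<le> (\<Sum>k. inverse l ^ Suc k)"
    using contraction_rate
    by (intro sum_le_suminf) (auto simp del: power_Suc simp: summable_Suc_iff intro!: summable_geometric zero_le_power)
  finally show ?thesis
    unfolding C_def using K_nonneg by (simp add: mult_left_mono mult_right_mono)
qed

text \<open>If the bound failed by some \<open>D > 0\<close>, then by \<open>increment_along_inverse_branch\<close> and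
  \<open>partial_sum_le\<close> the increment of \<open>b\<close> over every image of \<open>[x + m, y + m]\<close> under an iterate of \<open>G\<close> would
  be at least \<open>D\<close>. For a high iterate, \<open>[0, 1]\<close> contains more than \<open>M / D\<close> such disjoint images, which
  contradicts bounded variation.\<close>

lemma b_lipschitz_on_unit_cell:
  assumes "P < x" "x < y" "y < P + 1"
  shows "\<bar>b x - b y\<bar> \<le> C * \<bar>x - y\<bar>"
proof (rule ccontr)
  define D where "D = \<bar>b x - b y\<bar> - C * \<bar>x - y\<bar>"
  assume "\<not> ?thesis"
  hence "0 < D"
    by (simp add: D_def)
  then obtain N :: nat where N: "M < of_nat N * D"
    using reals_Archimedean3 by blast
  \<comment> \<open>With this \<open>n\<close> the iterate \<open>G ^^ n\<close> maps \<open>[P, P + N + 1]\<close>, and so the first \<open>N + 1\<close> cells, into \<open>[P, 1]\<close>.\<close>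
  obtain n where n: "P + of_nat N + 1 \<le> (F ^^ n) 1"
    using F_escapes[OF P_in(2)] by blast
  \<comment> \<open>The partition points are the images of \<open>x, y, x + 1, y + 1, \<dots>\<close>; the wanted increments are those
    from an even index to the next odd one.\<close>
  define s where "s = (\<lambda>i :: nat. (if even i then x else y) + of_nat (i div 2))"
  define t where "t = (\<lambda>i. (G ^^ n) (s i))"
  have G_mono: "(G ^^ n) u \<le> (G ^^ n) v" if "u \<le> v" for u v
    using that funpow_G_less_iff[of n v u] by linarith
  have s_mono: "s i \<le> s j" if "i \<le> j" for i j
  proof (cases "i div 2 = j div 2")
    case True
    hence "even i \<or> odd j"
      using that by presburger
    thus ?thesis
      using True assms by (auto simp: s_def)
  next
    case False
    hence "i div 2 + 1 \<le> j div 2"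
      using that div_le_mono[of i j 2] by linarith
    hence "of_nat (i div 2) + 1 \<le> (of_nat (j div 2) :: real)"
      by (metis of_nat_1 of_nat_add of_nat_le_iff)
    thus ?thesis
      using assms by (auto simp: s_def)
  qed
  have "mono_on {..2 * N} t"
    unfolding t_def by (auto intro!: mono_onI G_mono s_mono)
  moreover have "t i \<in> {0..1}" if "i \<le> 2 * N" for i
  proof -
    have "i div 2 \<le> N"
      using that by simp
    hence "of_nat (i div 2) \<le> (of_nat N :: real)"
      by (rule of_nat_mono)
    hence "P \<le> s i" "s i \<le> (F ^^ n) 1"
      using assms n unfolding s_def by auto
    hence "P \<le> t i" "t i \<le> 1"
      using G_mono[of P "s i"] G_mono[of "s i" "(F ^^ n) 1"] funpow_G_fixed[of n]
        funpow_G_eq_iff[of n "(F ^^ n) 1" 1] by (auto simp: t_def)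
    thus ?thesis
      using P_in(1) by simp
  qed
  ultimately have "(\<Sum>i<2 * N. \<bar>b (t (Suc i)) - b (t i)\<bar>) \<le> M"
    by (intro b_variation) auto
  moreover have "D \<le> \<bar>b (t (Suc (2 * m))) - b (t (2 * m))\<bar>" for m :: nat
  proof -
    have st: "s (2 * m) = x + of_nat m" "s (Suc (2 * m)) = y + of_nat m"
      by (simp_all add: s_def)
    have "b x - b y = b (x + of_nat m) - b (y + of_nat m)"
      using b_shift[of _ "int m"] by simp
    also have "\<dots> = b (t (2 * m)) - b (t (Suc (2 * m)))
        - (\<Sum>k<n. a ((G ^^ Suc k) (x + of_nat m)) - a ((G ^^ Suc k) (y + of_nat m)))"
      unfolding t_def st
      by (rule increment_along_inverse_branch[of _ "int m"]) (use assms in \<open>auto simp: cell_def\<close>)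
    finally show ?thesis
      using partial_sum_le[of "x + of_nat m" "y + of_nat m" n] unfolding D_def by (simp del: funpow.simps)
  qed
  hence "of_nat N * D \<le> (\<Sum>m<N. \<bar>b (t (Suc (2 * m))) - b (t (2 * m))\<bar>)"
    using sum_mono[of "{..<N}" "\<lambda>_. D"] by simp
  moreover have "\<dots> \<le> (\<Sum>i<2 * N. \<bar>b (t (Suc i)) - b (t i)\<bar>)"
    by (rule sum_even_indices_le[of "\<lambda>i. \<bar>b (t (Suc i)) - b (t i)\<bar>"]) simp
  ultimately show False
    using N by linarith
qed

lemma b_lipschitz_on_cell:
  assumes "x \<in> cell m" "y \<in> cell m"
  shows "\<bar>b x - b y\<bar> \<le> C * \<bar>x - y\<bar>"
proof -
  have shift: "b x = b (x - of_int m)" "b y = b (y - of_int m)"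
    using b_shift[of "x - of_int m" m] b_shift[of "y - of_int m" m] by simp_all
  have "P < x - of_int m" "x - of_int m < P + 1" "P < y - of_int m" "y - of_int m < P + 1"
    using assms by (auto simp: cell_def)
  thus ?thesis
    using b_lipschitz_on_unit_cell[of "x - of_int m" "y - of_int m"]
      b_lipschitz_on_unit_cell[of "y - of_int m" "x - of_int m"]
    unfolding shift by (cases x y rule: linorder_cases) (auto simp: abs_minus_commute)
qed

text \<open>The candidate for the transfer function: what \<open>increment_along_inverse_branch\<close> yields for \<open>b\<close> in
  the limit, normalised by \<open>\<psi> P = 0\<close>.\<close>

definition \<psi> :: "real \<Rightarrow> real"
  where "\<psi> x = - (\<Sum>k. a ((G ^^ Suc k) x) - a P)"

lemmas orbit_sum = contraction_orbit_sum_C1[OF G_deriv G'_cont G'_le contraction_rate G_fixed a_deriv a'_cont a'_le]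

lemma \<psi>_C1: "\<exists>\<psi>'. continuous_on UNIV \<psi>' \<and> (\<forall>x. (\<psi> has_real_derivative \<psi>' x) (at x))"
proof -
  obtain s' where "continuous_on UNIV s'"
    "\<And>x. ((\<lambda>x. \<Sum>k. a ((G ^^ Suc k) x) - a P) has_real_derivative s' x) (at x)"
    using orbit_sum(2) by blast
  thus ?thesis
    unfolding \<psi>_def[abs_def]
    by (intro exI[of _ "\<lambda>x. - s' x"]) (auto intro!: continuous_on_minus DERIV_minus simp del: funpow.simps)
qed

text \<open>The orbit of \<open>F x\<close> under \<open>G\<close> is that of \<open>x\<close> with \<open>x\<close> itself put in front, so the two series
  differ by the single term \<open>a x - a P\<close>.\<close>

lemma a_eq_\<psi>: "a x = a P + \<psi> x - \<psi> (F x)"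
proof -
  have "(G ^^ Suc k) (F x) = (G ^^ k) x" for k
    by (simp add: funpow_swap1)
  thus ?thesis
    using suminf_split_head[OF orbit_sum(1)[of "F x"]] unfolding \<psi>_def by (simp del: funpow.simps)
qed

text \<open>Both points stay in a common cell under \<open>G\<close> while their distance tends to 0, so by the
  Lipschitz bound the boundary term in \<open>increment_along_inverse_branch\<close> tends to 0.\<close>

lemma b_minus_\<psi>_constant_on_cell:
  assumes "x \<in> cell m" "y \<in> cell m"
  shows "b x - b y = \<psi> x - \<psi> y"
proof -
  have "(\<lambda>n. b ((G ^^ n) x) - b ((G ^^ n) y)) \<longlonglongrightarrow> 0"
  proof (rule Lim_null_comparison)
    show "(\<lambda>n. C * (inverse l ^ n * \<bar>x - y\<bar>)) \<longlonglongrightarrow> 0"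
      using contraction_rate by (intro tendsto_mult_right_zero tendsto_mult_left_zero LIMSEQ_realpow_zero)
    have C: "0 \<le> C"
      unfolding C_def using K_nonneg contraction_rate
      by (intro mult_nonneg_nonneg suminf_nonneg)
        (auto simp del: power_Suc simp: summable_Suc_iff intro!: summable_geometric zero_le_power)
    have "norm (b ((G ^^ n) x) - b ((G ^^ n) y)) \<le> C * (inverse l ^ n * \<bar>x - y\<bar>)" for n
    proof -
      obtain m' where "(G ^^ n) x \<in> cell m'" "(G ^^ n) y \<in> cell m'"
        using funpow_G_maps_cell[of m n] assms by blast
      from b_lipschitz_on_cell[OF this] mult_left_mono[OF funpow_G_contracts[of n x y] C]
      show ?thesis
        by simp
    qed
    thus "\<forall>\<^sub>F n in sequentially. norm (b ((G ^^ n) x) - b ((G ^^ n) y)) \<le> C * (inverse l ^ n * \<bar>x - y\<bar>)"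
      by simp
  qed
  moreover have "(\<lambda>n. \<Sum>k<n. a ((G ^^ Suc k) x) - a ((G ^^ Suc k) y)) \<longlonglongrightarrow> \<psi> y - \<psi> x"
    using sums_diff[OF summable_sums[OF orbit_sum(1)[of x]] summable_sums[OF orbit_sum(1)[of y]]]
    unfolding \<psi>_def sums_def by (simp del: funpow.simps)
  ultimately have "(\<lambda>n. b ((G ^^ n) x) - b ((G ^^ n) y)
      - (\<Sum>k<n. a ((G ^^ Suc k) x) - a ((G ^^ Suc k) y))) \<longlonglongrightarrow> 0 - (\<psi> y - \<psi> x)"
    by (rule tendsto_diff)
  hence "(\<lambda>_ :: nat. b x - b y) \<longlonglongrightarrow> 0 - (\<psi> y - \<psi> x)"
    unfolding increment_along_inverse_branch[OF assms, symmetric] .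
  thus ?thesis
    using LIMSEQ_const_iff by fastforce
qed

text \<open>The increment \<open>\<delta>\<close> over a period is constant on every cell, because \<open>\<psi>\<close> and the periodic
  function \<open>b\<close> differ there by a constant. It is continuous, hence constant on the line. Comparing
  \<open>a_eq_\<psi>\<close> at \<open>0\<close> and \<open>1\<close> shows that \<open>\<delta>\<close> equals \<open>d\<close> times itself.\<close>

lemma \<psi>_shift_1: "\<psi> (x + 1) = \<psi> x"
proof -
  define \<delta> where "\<delta> = (\<lambda>x. \<psi> (x + 1) - \<psi> x)"
  have \<psi>_cont: "continuous_on UNIV \<psi>"
    using \<psi>_C1 by (meson DERIV_continuous_on has_field_derivative_at_within)
  have \<delta>_cont: "continuous_on S \<delta>" for S
    unfolding \<delta>_def by (intro continuous_intros continuous_on_compose2[OF \<psi>_cont]) auto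
  have \<delta>_const_on_cell: "\<delta> u = \<delta> v" if "u \<in> cell m" "v \<in> cell m" for u v m
  proof -
    have "u + 1 \<in> cell (m + 1)" "v + 1 \<in> cell (m + 1)"
      using that by (auto simp: cell_def)
    from b_minus_\<psi>_constant_on_cell[OF this] b_minus_\<psi>_constant_on_cell[OF that]
    show ?thesis
      unfolding \<delta>_def b_shift_1 by linarith
  qed
  have \<delta>_deriv: "(\<delta> has_real_derivative 0) (at u)" if "u \<notin> range (\<lambda>j. P + of_int j)" for u
  proof -
    define m where "m = \<lfloor>u - P\<rfloor>"
    have "u \<noteq> P + of_int m"
      using that by blast
    hence u: "u \<in> cell m"
      using floor_correct[of "u - P"] unfolding cell_def m_def greaterThanLessThan_iff by linarith
    show ?thesis
    proof (rule has_field_derivative_transform_within_open)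
      show "((\<lambda>_. \<delta> u) has_real_derivative 0) (at u)"
        by simp
      show "open (cell m)"
        by (simp add: cell_def)
    qed (use u \<delta>_const_on_cell in blast)+
  qed
  have \<delta>_const: "\<delta> u = \<delta> v" for u v
  proof -
    \<comment> \<open>A bounded interval around both points contains only finitely many end points of cells.\<close>
    define R where "R = \<bar>u\<bar> + \<bar>v\<bar> + 1"
    define E where "E = (\<lambda>j. P + of_int j) ` {\<lfloor>-R - P\<rfloor>..\<lceil>R - P\<rceil>}"
    have off_E: "w \<notin> range (\<lambda>j. P + of_int j)" if "w \<in> {-R<..<R} - E" for w
    proof
      assume "w \<in> range (\<lambda>j. P + of_int j)"
      then obtain j where j: "w = P + of_int j"
        by blast
      hence "-R - P < of_int j" "of_int j < R - P"
        using that by auto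
      hence "j \<in> {\<lfloor>-R - P\<rfloor>..\<lceil>R - P\<rceil>}"
        by (auto simp: floor_le_iff le_ceiling_iff)
      thus False
        using that j by (auto simp: E_def)
    qed
    have "\<delta> constant_on {-R<..<R}"
      by (rule DERIV_zero_connected_constant_on[of _ E])
        (use off_E \<delta>_deriv \<delta>_cont in \<open>auto simp: E_def\<close>)
    moreover have "u \<in> {-R<..<R}" "v \<in> {-R<..<R}"
      unfolding R_def by auto
    ultimately show ?thesis
      unfolding constant_on_def by metis
  qed
  have iterate: "\<psi> (y + of_nat n) = \<psi> y + of_nat n * \<delta> 0" for y n
  proof (induction n)
    case (Suc n)
    have "\<psi> (y + of_nat n + 1) = \<psi> (y + of_nat n) + \<delta> 0"
      using \<delta>_const[of "y + of_nat n" 0] by (simp add: \<delta>_def)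
    thus ?case
      using Suc by (simp add: algebra_simps)
  qed simp
  have "\<delta> 0 = \<psi> (F 0 + of_nat (nat d)) - \<psi> (F 0)"
    using a_eq_\<psi>[of 0] a_eq_\<psi>[of "0 + 1"] a_shift_1[of 0] F_shift_1[of 0] degree_gt_1
    by (simp add: \<delta>_def)
  also have "\<dots> = of_nat (nat d) * \<delta> 0"
    unfolding iterate by simp
  finally have "\<delta> 0 = of_int d * \<delta> 0"
    using degree_gt_1 by simp
  hence "\<delta> 0 = 0"
    using degree_gt_1 by auto
  thus ?thesis
    using \<delta>_const[of x 0] by (simp add: \<delta>_def)
qed

end


section \<open>Passing between the circle and the line\<close>

lemma to_circle_rep: "to_circle (rep_circle c) = c"
  by (rule Quotient3_abs_rep[OF Quotient3_circle])

lemma to_circle_shift: "to_circle (x + of_int k) = to_circle x"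
  by (simp add: to_circle_eq_iff)

lemma obtain_unit_representative:
  obtains x where "to_circle x = c" "0 \<le> x" "x < 1"
proof
  show "to_circle (frac (rep_circle c)) = c"
    using to_circle_shift[of "frac (rep_circle c)" "\<lfloor>rep_circle c\<rfloor>"] to_circle_rep[of c]
    by (simp add: frac_def)
qed (auto intro: frac_lt_1)

lemma periodic_descends:
  fixes g :: "real \<Rightarrow> 'a"
  assumes "\<And>x. g (x + 1) = g x"
  shows "\<exists>h. \<forall>x. h (to_circle x) = g x"
proof -
  have "g (rep_circle (to_circle x)) = g x" for x
  proof -
    have "rep_circle (to_circle x) - x \<in> \<int>"
      using to_circle_rep[of "to_circle x"] by (simp add: to_circle_eq_iff)
    then obtain k where "rep_circle (to_circle x) = x + of_int k"
      by (auto elim!: Ints_cases simp: algebra_simps)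
    thus ?thesis
      by (simp add: periodic_shift[of g, OF assms])
  qed
  thus ?thesis
    by (intro exI[of _ "\<lambda>c. g (rep_circle c)"]) blast
qed

lemma continuous_on_circle_if_lift:
  fixes h :: "circle \<Rightarrow> real"
  assumes "continuous_on UNIV (\<lambda>x. h (to_circle x))"
  shows "continuous_on UNIV h"
proof -
  have "open (to_circle -` (h -` U))" if "open U" for U
    using assms that unfolding vimage_comp
    by (simp add: continuous_on_open_vimage o_def)
  thus ?thesis
    by (simp add: continuous_on_open_vimage open_circle_def)
qed

lemma C1_circle_fun_iff:
  "C1_circle_fun A \<longleftrightarrow> (\<exists>a'. continuous_on UNIV a' \<and>
    (\<forall>x. ((\<lambda>x. A (to_circle x)) has_real_derivative a' x) (at x)))"
  unfolding C1_circle_fun_def C1_differentiable_on_def has_real_derivative_iff_has_vector_derivative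
  by auto

lemma lifts_differ_by_constant:
  assumes "is_lift F f" "is_lift H f"
  shows "F x - H x = F y - H y"
proof (rule continuous_integer_valued_constant[of "\<lambda>x. F x - H x"])
  show "continuous_on UNIV (\<lambda>x. F x - H x)"
    using assms by (intro continuous_intros) (auto simp: is_lift_def)
  show "F x - H x \<in> \<int>" for x
    using assms by (simp add: is_lift_def flip: to_circle_eq_iff)
qed

text \<open>The hypotheses on \<open>f\<close> provide one lift with a continuous derivative and one whose derivative
  is bounded below. They differ by a constant, so one lift has both properties; subtracting an integer
  makes it fix \<open>P\<close>.\<close>

lemma obtain_expanding_lift:
  assumes "C2_circle_map f" "expanding f" "f p = p"
  obtains F F' l P d where "expanding_lift F F' l P d" "0 \<le> P" "P < 1" "to_circle P = p"
    "\<And>x. to_circle (F x) = f (to_circle x)"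
proof -
  obtain H where H: "is_lift H f" "\<And>x. H differentiable at x" "deriv H C1_differentiable_on UNIV"
    using assms(1) unfolding C2_circle_map_def by blast
  obtain H1 l where H1: "is_lift H1 f" "1 < l" "\<And>x. H1 differentiable at x" "\<And>x. l \<le> deriv H1 x"
    using assms(2) unfolding expanding_def by blast
  obtain P where P: "to_circle P = p" "0 \<le> P" "P < 1"
    by (rule obtain_unit_representative)
  have "to_circle (H P) = to_circle P"
    using H(1) P(1) assms(3) by (simp add: is_lift_def)
  then obtain k where k: "H P - P = of_int k"
    by (auto simp: to_circle_eq_iff elim: Ints_cases)
  define F where "F = (\<lambda>x. H x - of_int k)"
  have H_deriv: "(H has_real_derivative deriv H x) (at x)" for x
    using H(2) by (simp add: DERIV_deriv_iff_real_differentiable)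
  have "H1 = (\<lambda>x. H x + (H1 0 - H 0))"
    using lifts_differ_by_constant[OF H1(1) H(1), of _ 0] by (auto simp: fun_eq_iff algebra_simps)
  moreover have "((\<lambda>x. H x + (H1 0 - H 0)) has_real_derivative deriv H x) (at x)" for x
    using H_deriv by (auto intro!: derivative_eq_intros)
  ultimately have "deriv H1 x = deriv H x" for x
    by (metis DERIV_imp_deriv)
  hence expansion: "l \<le> deriv H x" for x
    using H1(4) by metis
  have "is_lift (\<lambda>x. H (x + 1)) f"
    using H(1) to_circle_shift[of _ 1] unfolding is_lift_def
    by (auto intro!: continuous_on_compose2[of UNIV H _ "\<lambda>x. x + 1"] continuous_intros)
  hence "H (x + 1) - H x = H (0 + 1) - H 0" for x
    by (rule lifts_differ_by_constant[OF _ H(1)])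
  moreover have "H (0 + 1) - H 0 \<in> \<int>"
    using H(1) to_circle_shift[of 0 1] by (simp add: is_lift_def flip: to_circle_eq_iff)
  ultimately obtain d where d: "\<And>x. H (x + 1) - H x = of_int d"
    by (metis Ints_cases)
  have "expanding_lift F (deriv H) l P d"
  proof
    show "(F has_real_derivative deriv H x) (at x)" for x
      unfolding F_def using H_deriv by (auto intro!: derivative_eq_intros)
    show "continuous_on UNIV (deriv H)"
      using H(3) by (rule C1_differentiable_imp_continuous_on)
    show "F (x + 1) = F x + of_int d" for x
      using d[of x] by (simp add: F_def)
  qed (use H1(2) expansion k in \<open>auto simp: F_def\<close>)
  moreover have "to_circle (F x) = f (to_circle x)" for x
    using H(1) to_circle_shift[of "H x" "-k"] by (simp add: F_def is_lift_def)
  ultimately show thesis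
    using that P by blast
qed

context expanding_lift
begin

lemma cell_avoids_fixed: "x \<in> cell m \<Longrightarrow> to_circle x \<noteq> to_circle P"
proof
  assume x: "x \<in> cell m" "to_circle x = to_circle P"
  then obtain k where "x - P = of_int k"
    by (auto simp: to_circle_eq_iff elim: Ints_cases)
  hence "of_int m < (of_int k :: real)" "(of_int k :: real) < of_int (m + 1)"
    using x(1) by (auto simp: cell_def)
  hence "m < k" "k < m + 1"
    by (simp_all only: of_int_less_iff)
  thus False
    by linarith
qed

lemma inj_on_to_circle_cell: "inj_on to_circle (cell m)"
proof (rule inj_onI, rule ccontr)
  fix x y assume xy: "x \<in> cell m" "y \<in> cell m" "to_circle x = to_circle y" "x \<noteq> y"
  hence "1 \<le> \<bar>x - y\<bar>"
    by (intro Ints_nonzero_abs_ge1) (auto simp: to_circle_eq_iff)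
  thus False
    using xy(1,2) by (auto simp: cell_def)
qed

lemma G_image_cell: "G ` cell m = {G (P + of_int m) <..< G (P + of_int m + 1)}"
proof
  show "{G (P + of_int m) <..< G (P + of_int m + 1)} \<subseteq> G ` cell m"
  proof
    fix z assume "z \<in> {G (P + of_int m) <..< G (P + of_int m + 1)}"
    hence "F z \<in> cell m"
      using G_less_iff[of "P + of_int m" "F z"] G_less_iff[of "F z" "P + of_int m + 1"] by (simp add: cell_def)
    thus "z \<in> G ` cell m"
      by (metis G_F imageI)
  qed
qed (auto simp: cell_def G_less_iff)

text \<open>The end points of \<open>G ` cell m\<close> are consecutive preimages of representatives of the fixed
  point. An interval \<open>I\<close> whose projection contains that of \<open>G ` cell m\<close> meets a translate of
  \<open>G ` cell m\<close>; if it avoids the cut points, it cannot leave that translate, which gives maximality.\<close>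

lemma invertibility_domain_cell:
  assumes "\<And>x. to_circle (F x) = f (to_circle x)"
  shows "invertibility_domain f (to_circle P) (to_circle ` G ` cell m)"
  unfolding invertibility_domain_def
proof (intro conjI allI impI)
  have f_G: "f (to_circle (G x)) = to_circle x" for x
    using assms[of "G x"] by simp
  show "uncut_injective f (to_circle P) (to_circle ` G ` cell m)"
    unfolding uncut_injective_def
  proof (intro conjI)
    show "circle_interval (to_circle ` G ` cell m)"
      unfolding circle_interval_def G_image_cell using is_interval_oo by blast
    show "to_circle ` G ` cell m \<inter> f -` {to_circle P} = {}"
      using cell_avoids_fixed by (auto simp: f_G)
    show "inj_on f (to_circle ` G ` cell m)"
      using inj_on_to_circle_cell[of m] by (auto simp: inj_on_def f_G)
  qed
  fix D' assume D': "uncut_injective f (to_circle P) D' \<and> to_circle ` G ` cell m \<subseteq> D'"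
  then obtain I where I: "is_interval I" "D' = to_circle ` I"
    by (auto simp: uncut_injective_def circle_interval_def)
  have uncut: "F z \<noteq> P + of_int j" if "z \<in> I" for z j
  proof
    assume "F z = P + of_int j"
    hence "f (to_circle z) = to_circle P"
      by (simp add: to_circle_shift flip: assms)
    thus False
      using D' that I(2) by (auto simp: uncut_injective_def)
  qed
  define x0 where "x0 = P + of_int m + 1 / 2"
  have x0: "x0 \<in> cell m"
    by (simp add: x0_def cell_def)
  hence "to_circle (G x0) \<in> to_circle ` I"
    using D' I(2) by auto
  then obtain z0 where z0: "z0 \<in> I" "to_circle z0 = to_circle (G x0)"
    by force
  then obtain k where "z0 - G x0 = of_int k"
    by (auto simp: to_circle_eq_iff elim: Ints_cases)
  hence "F z0 = x0 + of_int (d * k)"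
    using F_shift[of "G x0" k] by (simp add: algebra_simps)
  hence F_z0: "P + of_int (m + d * k) < F z0" "F z0 < P + of_int (m + d * k + 1)"
    using x0 by (auto simp: cell_def)
  have F_I: "P + of_int (m + d * k) < F z \<and> F z < P + of_int (m + d * k + 1)" if z: "z \<in> I" for z
  proof -
    \<comment> \<open>An interval that reaches beyond the translate contains one of its end points.\<close>
    have cut: False if "G (P + of_int j) \<in> I" for j
      using uncut[OF that, of j] by simp
    show ?thesis
    proof (rule ccontr)
      assume "\<not> ?thesis"
      then consider "F z \<le> P + of_int (m + d * k)" | "P + of_int (m + d * k + 1) \<le> F z"
        by linarith
      thus False
      proof cases
        case 1
        hence "z \<le> G (P + of_int (m + d * k))" "G (P + of_int (m + d * k)) \<le> z0"
          using G_le_iff[of "F z" "P + of_int (m + d * k)"] G_le_iff[of "P + of_int (m + d * k)" "F z0"]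
            F_z0(1) unfolding G_F by linarith+
        thus False
          using cut mem_is_interval_1_I[OF I(1) z z0(1)] by blast
      next
        case 2
        hence "z0 \<le> G (P + of_int (m + d * k + 1))" "G (P + of_int (m + d * k + 1)) \<le> z"
          using G_le_iff[of "F z0" "P + of_int (m + d * k + 1)"]
            G_le_iff[of "P + of_int (m + d * k + 1)" "F z"] F_z0(2) unfolding G_F by linarith+
        thus False
          using cut mem_is_interval_1_I[OF I(1) z0(1) z] by blast
      qed
    qed
  qed
  have "to_circle z \<in> to_circle ` G ` cell m" if "z \<in> I" for z
  proof -
    have "F z + of_int (d * (-k)) \<in> cell m"
      using F_I[OF that] by (simp add: cell_def)
    moreover have "to_circle z = to_circle (G (F z + of_int (d * (-k))))"
      using to_circle_shift[of z "-k"] by (simp only: G_shift G_F)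
    ultimately show ?thesis
      by blast
  qed
  thus "D' = to_circle ` G ` cell m"
    using D' I(2) by blast
qed

end


section \<open>The coboundary on the circle\<close>

lemma invariant_integral_of_coboundary:
  assumes \<mu>: "prob_space \<mu>" "sets \<mu> = sets borel" "f \<in> measurable \<mu> \<mu>" "distr \<mu> \<mu> f = \<mu>"
    and \<phi>: "\<phi> \<in> borel_measurable borel" "\<And>x. \<bar>\<phi> x\<bar> \<le> (B :: real)"
  shows "(\<integral>x. c + \<phi> x - \<phi> (f x) \<partial>\<mu>) = c"
proof -
  interpret prob_space \<mu> by fact
  have meas: "\<phi> \<in> borel_measurable \<mu>"
    using \<phi>(1) measurable_cong_sets[OF \<mu>(2) refl] by blast
  hence int: "integrable \<mu> \<phi>"
    using \<phi>(2) by (intro integrable_const_bound[of _ B]) auto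
  hence "integrable \<mu> (\<lambda>x. \<phi> (f x))"
    using integrable_distr[OF \<mu>(3), of \<phi>] \<mu>(4) by simp
  moreover have "(\<integral>x. \<phi> (f x) \<partial>\<mu>) = (\<integral>x. \<phi> x \<partial>\<mu>)"
    using integral_distr[OF \<mu>(3) meas] \<mu>(4) by simp
  ultimately show ?thesis
    using int by (simp add: prob_space)
qed

text \<open>The periodic function \<open>\<psi>\<close> descends to the circle. The constant is \<open>A p\<close>, since a coboundary
  vanishes at a fixed point.\<close>

lemma c_constant_cohomologous_to_constant:
  assumes "C2_circle_map f" "expanding f" "f p = p" "C1_circle_fun A" "c_constant f p A"
  shows "\<exists>\<phi>. C1_circle_fun \<phi> \<and> (\<forall>x. A x = A p + \<phi> x - \<phi> (f x))"
proof -
  obtain F F' l P d where lift: "expanding_lift F F' l P d" "0 \<le> P" "P < 1" "to_circle P = p"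
    "\<And>x. to_circle (F x) = f (to_circle x)"
    using obtain_expanding_lift[OF assms(1-3)] by metis
  interpret expanding_lift F F' l P d by fact
  obtain \<beta> where \<beta>: "bounded_variation \<beta>"
    "\<And>D. invertibility_domain f p D \<Longrightarrow> (\<lambda>x. A x + \<beta> (f x) - \<beta> x) constant_on D"
    using assms(5) unfolding c_constant_def by blast
  obtain M where M: "\<And>n t. mono_on {..n} t \<Longrightarrow> t ` {..n} \<subseteq> {0..1} \<Longrightarrow>
      (\<Sum>i<n. \<bar>\<beta> (to_circle (t (Suc i))) - \<beta> (to_circle (t i))\<bar>) \<le> M"
    using \<beta>(1) unfolding bounded_variation_def by blast
  define a where "a = (\<lambda>x. A (to_circle x))"
  obtain a' where a': "continuous_on UNIV a'" "\<And>x. (a has_real_derivative a' x) (at x)"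
    using assms(4) unfolding C1_circle_fun_iff a_def by blast
  have a_shift: "a (x + 1) = a x" for x
    using to_circle_shift[of x 1] by (simp add: a_def)
  have "a' (x + 1) = a' x" for x
    using DERIV_unique[OF a'(2)[of x]] a'(2)[of "x + 1"] DERIV_shift[of a "a' (x + 1)" x 1] a_shift
    by simp
  then obtain K where K: "\<And>x. \<bar>a' x\<bar> \<le> K"
    using periodic_continuous_bounded a'(1) by metis
  interpret c_constant_lift F F' l P d a a' "\<lambda>x. \<beta> (to_circle x)" K M
  proof
    show "a (G x) + \<beta> (to_circle x) - \<beta> (to_circle (G x))
        = a (G y) + \<beta> (to_circle y) - \<beta> (to_circle (G y))" if "x \<in> cell m" "y \<in> cell m" for x y m
    proof -
      have "f (to_circle (G z)) = to_circle z" for z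
        using lift(5)[of "G z"] by simp
      thus ?thesis
        using \<beta>(2)[of "to_circle ` G ` cell m"] invertibility_domain_cell[OF lift(5), of m] that
        unfolding lift(4) constant_on_def a_def by force
    qed
    show "\<beta> (to_circle (x + 1)) = \<beta> (to_circle x)" for x
      using to_circle_shift[of x 1] by simp
  qed (use a' K a_shift lift(2,3) M in auto)
  obtain \<phi> where \<phi>: "\<And>x. \<phi> (to_circle x) = \<psi> x"
    using periodic_descends[of \<psi>, OF \<psi>_shift_1] by blast
  have "C1_circle_fun \<phi>"
    using \<psi>_C1 unfolding C1_circle_fun_iff \<phi> .
  moreover have "A x = A p + \<phi> x - \<phi> (f x)" for x
  proof -
    have "\<psi> (rep_circle x) = \<phi> x" "\<psi> (F (rep_circle x)) = \<phi> (f x)"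
      using lift(5)[of "rep_circle x"] by (simp_all add: to_circle_rep flip: \<phi>)
    moreover have "a (rep_circle x) = A x" "a P = A p"
      using lift(4) by (simp_all add: a_def to_circle_rep)
    ultimately show ?thesis
      using a_eq_\<psi>[of "rep_circle x"] by simp
  qed
  ultimately show ?thesis
    by blast
qed

theorem lemmaA20:
  fixes f :: "circle \<Rightarrow> circle" and p :: circle and A :: "circle \<Rightarrow> real"
    and \<mu> :: "circle measure"
  assumes "C2_circle_map f"
    and "expanding f"
    and "f p = p"
    and "ac_invariant_prob f \<mu>"
    and "C1_circle_fun A"
    and "c_constant f p A"
    and "(\<integral>x. A x \<partial>\<mu>) = 0"
  shows "\<exists>\<phi>. C1_circle_fun \<phi> \<and> (\<forall>x. A x = \<phi> x - \<phi> (f x))"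
proof -
  obtain \<phi> where \<phi>: "C1_circle_fun \<phi>" "\<And>x. A x = A p + \<phi> x - \<phi> (f x)"
    using c_constant_cohomologous_to_constant[OF assms(1-3,5,6)] by blast
  obtain \<psi>' where "\<And>x. ((\<lambda>x. \<phi> (to_circle x)) has_real_derivative \<psi>' x) (at x)"
    using \<phi>(1) unfolding C1_circle_fun_iff by blast
  hence lift_cont: "continuous_on UNIV (\<lambda>x. \<phi> (to_circle x))"
    by (meson DERIV_continuous_on has_field_derivative_at_within)
  hence "\<phi> \<in> borel_measurable borel"
    by (intro borel_measurable_continuous_onI continuous_on_circle_if_lift)
  moreover obtain B where "\<And>x. \<bar>\<phi> (to_circle x)\<bar> \<le> B"
    using periodic_continuous_bounded[OF _ lift_cont] to_circle_shift[of _ 1] by auto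
  hence "\<And>x. \<bar>\<phi> x\<bar> \<le> B"
    by (metis to_circle_rep)
  ultimately have "(\<integral>x. A p + \<phi> x - \<phi> (f x) \<partial>\<mu>) = A p"
    using assms(4) unfolding ac_invariant_prob_def by (intro invariant_integral_of_coboundary) auto
  hence "A p = 0"
    using assms(7) by (simp flip: \<phi>(2))
  hence "A x = \<phi> x - \<phi> (f x)" for x
    using \<phi>(2)[of x] by linarith
  thus ?thesis
    using \<phi>(1) by blast
qed

end
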